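(* For $n\ge1$, there is an involution on the set of free Schröder paths of length $2n$ containing at least one up step that reverses the parity of the number of flaw blocks; consequently \[\sum_{i=0}^{n}(-1)^i\,a(n-i,2i+1)=1.\]
   Context: A free Schröder path of length $2n$ is a lattice path from $(0,0)$ to $(2n,0)$ with steps $U=(1,1)$, $H=(2,0)$, $D=(1,-1)$. A flaw block is a maximal segment that starts and ends on the $x$-axis and is otherwise strictly below it; their number equals the number of $D$ steps from height $0$ to $-1$. Let $S=S(x)$ be the power series determined by $S=1+xS+xS^2$ (generating function of the large Schröder numbers), and $a(n,k)=[x^n]S^k$ the coefficient of $x^n$ in $S^k$, with $a(0,k)=1$. *)

theory Defs
  imports "HOL-Library.Product_Plus" "HOL-Computational_Algebra.Formal_Power_Series"
begin

datatype step = Up | Level | Down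

fun vec :: "step \<Rightarrow> int \<times> int" where
  "vec Up = (1, 1)"
| "vec Level = (2, 0)"
| "vec Down = (1, - 1)"

text \<open>The lattice point reached from the origin after the first \<open>i\<close> steps.\<close>

definition point :: "step list \<Rightarrow> nat \<Rightarrow> int \<times> int" where
  "point p i = (\<Sum>s\<leftarrow>take i p. vec s)"

definition free_schroder_paths :: "nat \<Rightarrow> step list set" where
  "free_schroder_paths n = {p. point p (length p) = (2 * int n, 0)}"

abbreviation height :: "step list \<Rightarrow> nat \<Rightarrow> int" where
  "height p i \<equiv> snd (point p i)"

text \<open>A pair \<open>(i, j)\<close> stands for the segment of the path from its \<open>i\<close>-th to its \<open>j\<close>-th lattice
  point. The condition \<open>Suc i < j\<close> excludes single points and single level steps on the axis:
  the latter have no lattice point between their ends, but their midpoint lies on the axis.\<close>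

definition below_axis_segment :: "step list \<Rightarrow> nat \<Rightarrow> nat \<Rightarrow> bool" where
  "below_axis_segment p i j \<longleftrightarrow>
     Suc i < j \<and> j \<le> length p \<and> height p i = 0 \<and> height p j = 0 \<and>
     (\<forall>k. i < k \<and> k < j \<longrightarrow> height p k < 0)"

definition flaw_blocks :: "step list \<Rightarrow> (nat \<times> nat) set" where
  "flaw_blocks p = {(i, j). below_axis_segment p i j \<and>
     (\<forall>i' j'. below_axis_segment p i' j' \<and> i' \<le> i \<and> j \<le> j' \<longrightarrow> i' = i \<and> j' = j)}"

definition num_flaw_blocks :: "step list \<Rightarrow> nat" where
  "num_flaw_blocks p = card (flaw_blocks p)"

definition schroder_fps :: "int fps" where
  "schroder_fps = (THE S. S = 1 + fps_X * S + fps_X * S\<^sup>2)"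

definition a :: "nat \<Rightarrow> nat \<Rightarrow> int" where
  "a n k = fps_nth (schroder_fps ^ k) n"


lemma height_Suc:
  assumes "i < length p"
  shows "height p (Suc i) = height p i + snd (vec (p ! i))"
  using assms by (simp add: point_def take_Suc_conv_app_nth)

lemma height_0 [simp]: "height p 0 = 0"
  by (simp add: point_def zero_prod_def)

lemma below_axis_segment_first_step:
  assumes "below_axis_segment p i j"
  shows "i < length p" "p ! i = Down" "height p i = 0"
proof -
  show i: "i < length p" and h: "height p i = 0"
    using assms by (auto simp: below_axis_segment_def)
  have "height p (Suc i) < 0"
    using assms by (auto simp: below_axis_segment_def)
  with i h show "p ! i = Down"
    by (cases "p ! i") (auto simp: height_Suc)
qed

lemma below_axis_segment_maximal:
  assumes "below_axis_segment p i j" "below_axis_segment p i' j'" "i' \<le> i" "j \<le> j'"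
  shows "i' = i \<and> j' = j"
proof (rule ccontr)
  assume "\<not> ?thesis"
  then have "(i' < i \<and> i < j') \<or> (i' < j \<and> j < j')"
    using assms by (auto simp: below_axis_segment_def)
  then show False
    using assms unfolding below_axis_segment_def by (metis less_irrefl)
qed

lemma below_axis_segment_end_unique:
  assumes "below_axis_segment p i j" "below_axis_segment p i j'"
  shows "j = j'"
proof (cases "j \<le> j'")
  case True
  then show ?thesis
    using below_axis_segment_maximal[OF assms] by simp
next
  case False
  then show ?thesis
    using below_axis_segment_maximal[OF assms(2,1)] by simp
qed

lemma below_axis_segment_exists:
  assumes "height p (length p) = 0" "i < length p" "p ! i = Down" "height p i = 0"
  shows "\<exists>j. below_axis_segment p i j"
proof -
  define j where "j = (LEAST j. Suc i < j \<and> j \<le> length p \<and> height p j \<ge> 0)"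
  have neg: "height p (Suc i) < 0"
    using assms by (simp add: height_Suc)
  then have "Suc i < length p"
    using assms by (cases "Suc i = length p") auto
  have j: "Suc i < j \<and> j \<le> length p \<and> height p j \<ge> 0"
    unfolding j_def by (rule LeastI[of _ "length p"]) (use assms \<open>Suc i < length p\<close> in auto)
  have below: "height p k < 0" if "i < k" "k < j" for k
  proof (cases "k = Suc i")
    case False
    have "\<not> (Suc i < k \<and> k \<le> length p \<and> height p k \<ge> 0)"
      using that(2) unfolding j_def by (rule not_less_Least)
    then show ?thesis
      using that j False by linarith
  qed (use neg in simp)
  obtain m where m: "j = Suc m"
    using j by (cases j) auto
  have "height p m < 0"
    using below j m by auto
  moreover have "height p j = height p m + snd (vec (p ! m))"
    using j m by (simp add: height_Suc)
  ultimately have "height p j = 0"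
    using j by (cases "p ! m") auto
  then show ?thesis
    using j below assms by (auto simp: below_axis_segment_def)
qed

lemma num_flaw_blocks_eq_card_Down:
  assumes "p \<in> free_schroder_paths n"
  shows "num_flaw_blocks p = card {i. i < length p \<and> p ! i = Down \<and> height p i = 0}"
proof -
  have eq: "flaw_blocks p = {(i, j). below_axis_segment p i j}"
    unfolding flaw_blocks_def using below_axis_segment_maximal by blast
  have h: "height p (length p) = 0"
    using assms by (simp add: free_schroder_paths_def)
  have "bij_betw fst (flaw_blocks p) {i. i < length p \<and> p ! i = Down \<and> height p i = 0}"
    unfolding bij_betw_def
  proof
    show "inj_on fst (flaw_blocks p)"
      unfolding eq by (auto intro!: inj_onI dest: below_axis_segment_end_unique)
    show "fst ` flaw_blocks p = {i. i < length p \<and> p ! i = Down \<and> height p i = 0}"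
    proof (intro set_eqI iffI)
      fix i
      assume "i \<in> fst ` flaw_blocks p"
      then obtain j where "below_axis_segment p i j"
        unfolding eq by auto
      then show "i \<in> {i. i < length p \<and> p ! i = Down \<and> height p i = 0}"
        using below_axis_segment_first_step by blast
    next
      fix i
      assume "i \<in> {i. i < length p \<and> p ! i = Down \<and> height p i = 0}"
      then obtain j where "below_axis_segment p i j"
        using below_axis_segment_exists[OF h] by blast
      then show "i \<in> fst ` flaw_blocks p"
        unfolding eq by force
    qed
  qed
  then show ?thesis
    unfolding num_flaw_blocks_def by (rule bij_betw_same_card)
qed

function large_schroder :: "nat \<Rightarrow> int" where
  "large_schroder 0 = 1"
| "large_schroder (Suc n) =
     large_schroder n + (\<Sum>i=0..n. large_schroder i * large_schroder (n - i))"
  by pat_completeness auto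
termination by (relation "measure id") auto

lemma schroder_eq_iff:
  fixes S :: "int fps"
  shows "S = 1 + fps_X * S + fps_X * S\<^sup>2 \<longleftrightarrow> S = Abs_fps large_schroder"
proof
  let ?T = "Abs_fps large_schroder"
  show "S = 1 + fps_X * S + fps_X * S\<^sup>2" if "S = ?T"
    unfolding that
  proof (rule fps_ext)
    fix n
    show "fps_nth ?T n = fps_nth (1 + fps_X * ?T + fps_X * ?T\<^sup>2) n"
      by (cases n) (simp_all add: power2_eq_square fps_mult_nth[of ?T ?T])
  qed
  assume S: "S = 1 + fps_X * S + fps_X * S\<^sup>2"
  have S0: "fps_nth S 0 = 1"
    by (subst S) simp
  have S_Suc: "fps_nth S (Suc n) = fps_nth S n + (\<Sum>i=0..n. fps_nth S i * fps_nth S (n - i))" for n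
    by (subst S) (simp add: power2_eq_square fps_mult_nth[of S S])
  have "fps_nth S n = large_schroder n" for n
  proof (induction n rule: less_induct)
    case (less n)
    show ?case
    proof (cases n)
      case (Suc m)
      have "(\<Sum>i=0..m. fps_nth S i * fps_nth S (m - i)) =
            (\<Sum>i=0..m. large_schroder i * large_schroder (m - i))"
        using less Suc by (intro sum.cong) auto
      then show ?thesis
        using less Suc S_Suc by simp
    qed (simp add: S0)
  qed
  then show "S = ?T"
    by (simp add: fps_eq_iff)
qed

lemma schroder_fps_ex1: "\<exists>!S :: int fps. S = 1 + fps_X * S + fps_X * S\<^sup>2"
  unfolding schroder_eq_iff by simp

lemma schroder_fps_eq: "schroder_fps = 1 + fps_X * schroder_fps + fps_X * schroder_fps\<^sup>2"
  unfolding schroder_fps_def by (rule theI'[OF schroder_fps_ex1])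

lemma a_0: "a 0 k = 1"
proof -
  have "fps_nth schroder_fps 0 = 1"
    by (subst schroder_fps_eq) simp
  then show ?thesis
    by (simp add: a_def fps_power_zeroth)
qed

end

theory Submission
  imports Defs
begin

text \<open>A path with an up step is not flat. Reflecting its first excursion away from the axis, up to
  the first return, turns a flaw block into a positive block or conversely and leaves everything
  else alone, which gives the involution.

  For the identity, \<open>S = 1 + xS + xS\<^sup>2\<close> says \<open>1 + xS\<^sup>2 = (1 - x)S\<close>, so the alternating sum is the
  coefficient of \<open>x\<^sup>n\<close> in \<open>\<Sum>\<^sub>i S (- xS\<^sup>2)\<^sup>i = S / (1 + xS\<^sup>2) = 1 / (1 - x)\<close>.\<close>

section \<open>The involution\<close>

fun reflect_step :: "step \<Rightarrow> step" where
  "reflect_step Up = Down"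
| "reflect_step Level = Level"
| "reflect_step Down = Up"

lemma reflect_step_involutive [simp]: "reflect_step (reflect_step s) = s"
  by (cases s) auto

lemma vec_reflect_step: "vec (reflect_step s) = (fst (vec s), - snd (vec s))"
  by (cases s) auto

text \<open>Here \<open>h\<close> is the height of the original path before the next step. The image
  is then at \<open>- h\<close>, so both meet the axis after the same step and the remainder can be
  copied.\<close>

fun reflect_until_axis :: "int \<Rightarrow> step list \<Rightarrow> step list" where
  "reflect_until_axis h [] = []"
| "reflect_until_axis h (s # p) = reflect_step s #
     (if h + snd (vec s) = 0 then p else reflect_until_axis (h + snd (vec s)) p)"

fun reflect_first_excursion :: "step list \<Rightarrow> step list" where
  "reflect_first_excursion [] = []"
| "reflect_first_excursion (Level # p) = Level # reflect_first_excursion p"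
| "reflect_first_excursion (Up # p) = Down # reflect_until_axis 1 p"
| "reflect_first_excursion (Down # p) = Up # reflect_until_axis (- 1) p"

text \<open>A recursive form of the count in \<open>num_flaw_blocks_eq_card_Down\<close>; the free
  starting height lets inductions run from the middle of an excursion.\<close>

fun downs_from_axis :: "int \<Rightarrow> step list \<Rightarrow> nat" where
  "downs_from_axis h [] = 0"
| "downs_from_axis h (s # p) =
     (if h = 0 \<and> s = Down then 1 else 0) + downs_from_axis (h + snd (vec s)) p"

lemma point_Cons_Suc: "point (s # p) (Suc i) = vec s + point p i"
  by (simp add: point_def)

lemma downs_from_axis_eq_sum:
  "downs_from_axis h p =
     (\<Sum>i<length p. if p ! i = Down \<and> h + height p i = 0 then 1 else 0)"
proof (induction p arbitrary: h)
  case (Cons s p)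
  have "downs_from_axis (h + snd (vec s)) p =
      (\<Sum>i<length p. if p ! i = Down \<and> h + height (s # p) (Suc i) = 0 then 1 else 0)"
    by (simp add: Cons.IH point_Cons_Suc add.assoc)
  then show ?case
    by (simp add: sum.lessThan_Suc_shift conj_commute del: sum.lessThan_Suc)
qed simp

lemma num_flaw_blocks_eq_downs_from_axis:
  assumes "p \<in> free_schroder_paths n"
  shows "num_flaw_blocks p = downs_from_axis 0 p"
proof -
  have "downs_from_axis 0 p =
      card ({..<length p} \<inter> {i. p ! i = Down \<and> height p i = 0})"
    by (simp add: downs_from_axis_eq_sum sum.If_cases)
  also have "{..<length p} \<inter> {i. p ! i = Down \<and> height p i = 0} =
      {i. i < length p \<and> p ! i = Down \<and> height p i = 0}"
    by auto
  finally show ?thesis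
    using num_flaw_blocks_eq_card_Down[OF assms] by simp
qed

lemma free_schroder_paths_iff:
  "p \<in> free_schroder_paths n \<longleftrightarrow> sum_list (map vec p) = (2 * int n, 0)"
  by (simp add: free_schroder_paths_def point_def)

lemma reflect_until_axis_involutive:
  "reflect_until_axis (- h) (reflect_until_axis h p) = p"
proof (induction h p rule: reflect_until_axis.induct)
  case (2 h s p)
  have "- h - snd (vec s) = 0 \<longleftrightarrow> h + snd (vec s) = 0"
    by linarith
  with 2 show ?case
    by (simp add: vec_reflect_step)
qed simp

text \<open>As \<open>h\<close> is nonzero, no step up to the first return starts on the axis in
  either path, so none is counted; afterwards the paths coincide.\<close>

lemma downs_from_axis_reflect_until_axis:
  assumes "h \<noteq> 0"
  shows "downs_from_axis (- h) (reflect_until_axis h p) = downs_from_axis h p"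
  using assms
proof (induction h p rule: reflect_until_axis.induct)
  case (2 h s p)
  show ?case
  proof (cases "h + snd (vec s) = 0")
    case True
    then have "snd (vec s) = - h"
      by linarith
    with 2(2) show ?thesis
      by (simp add: vec_reflect_step)
  next
    case False
    with 2 show ?thesis
      by (simp add: vec_reflect_step)
  qed
qed simp

text \<open>Total rises \<open>- h\<close> and \<open>h\<close> mean ending on the axis from heights
  \<open>h\<close> and \<open>- h\<close>. Reflection keeps step widths, and a copied remainder
  starts on the axis in both paths.\<close>

lemma sum_vec_reflect_until_axis:
  assumes "sum_list (map vec p) = (x, - h)"
  shows "sum_list (map vec (reflect_until_axis h p)) = (x, h)"
  using assms
proof (induction h p arbitrary: x rule: reflect_until_axis.induct)
  case (1 h)
  then show ?case
    by (simp add: zero_prod_def)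
next
  case (2 h s p)
  have p: "sum_list (map vec p) = (x - fst (vec s), - (h + snd (vec s)))"
    using 2(2) by (cases "vec s"; cases "sum_list (map vec p)") auto
  show ?case
  proof (cases "h + snd (vec s) = 0")
    case True
    with p show ?thesis
      by (simp add: vec_reflect_step)
  next
    case False
    with 2(1)[OF False p] show ?thesis
      by (simp add: vec_reflect_step)
  qed
qed

lemma reflect_first_excursion_involutive:
  "reflect_first_excursion (reflect_first_excursion p) = p"
  using reflect_until_axis_involutive[of 1] reflect_until_axis_involutive[of "- 1"]
  by (induction p rule: reflect_first_excursion.induct) simp_all

lemma sum_vec_reflect_first_excursion:
  assumes "sum_list (map vec p) = (x, 0)"
  shows "sum_list (map vec (reflect_first_excursion p)) = (x, 0)"
  using assms
proof (induction p arbitrary: x rule: reflect_first_excursion.induct)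
  case (2 p)
  then have "sum_list (map vec p) = (x - 2, 0)"
    by (cases "sum_list (map vec p)") auto
  with 2 show ?case
    by simp
next
  case (3 p)
  then have "sum_list (map vec p) = (x - 1, - 1)"
    by (cases "sum_list (map vec p)") auto
  then show ?case
    by (simp add: sum_vec_reflect_until_axis)
next
  case (4 p)
  \<comment> \<open>Written as \<open>- (- 1)\<close> to match \<open>- h\<close> at
    \<open>h = - 1\<close>.\<close>
  then have "sum_list (map vec p) = (x - 1, - (- 1))"
    by (cases "sum_list (map vec p)") auto
  from sum_vec_reflect_until_axis[OF this] show ?case
    by simp
qed simp

text \<open>Leading level steps count nothing. The first other step leaves the axis, and exchanging
  \<open>Up\<close> and \<open>Down\<close> there changes the count by one; the rest counts equally
  from heights \<open>1\<close> and \<open>- 1\<close>.\<close>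

lemma downs_from_axis_reflect_first_excursion:
  assumes "\<not> set p \<subseteq> {Level}"
  shows "even (downs_from_axis 0 (reflect_first_excursion p)) \<longleftrightarrow> odd (downs_from_axis 0 p)"
  using assms downs_from_axis_reflect_until_axis[of 1]
    downs_from_axis_reflect_until_axis[of "- 1"]
  by (induction p rule: reflect_first_excursion.induct) simp_all

lemma reflect_first_excursion_not_flat:
  "\<not> set p \<subseteq> {Level} \<Longrightarrow> \<not> set (reflect_first_excursion p) \<subseteq> {Level}"
  by (induction p rule: reflect_first_excursion.induct) simp_all

text \<open>Only \<open>Up\<close> gains height, so a path back on the axis that has a
  \<open>Down\<close> also has an \<open>Up\<close>. This lets "not flat", which reflection clearly
  preserves, replace "has an up step".\<close>

lemma sum_vec_no_Up:
  assumes "Up \<notin> set p"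
  shows "snd (sum_list (map vec p)) \<le> 0 \<and>
    (Down \<in> set p \<longrightarrow> snd (sum_list (map vec p)) < 0)"
  using assms
proof (induction p)
  case (Cons s p)
  then show ?case
    by (cases s) auto
qed simp

lemma Up_in_free_schroder_path_iff:
  assumes "p \<in> free_schroder_paths n"
  shows "Up \<in> set p \<longleftrightarrow> \<not> set p \<subseteq> {Level}"
proof
  assume "\<not> set p \<subseteq> {Level}"
  then have "Up \<in> set p \<or> Down \<in> set p"
    by (metis (full_types) singletonI step.exhaust subsetI)
  then show "Up \<in> set p"
    using sum_vec_no_Up[of p] assms by (auto simp: free_schroder_paths_iff)
qed auto

section \<open>The alternating sum\<close>

lemma alternating_schroder_sum: "(\<Sum>i=0..n. (- 1) ^ i * a (n - i) (2 * i + 1)) = 1"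
proof -
  let ?S = schroder_fps
  define q :: "int fps" where "q = - (fps_X * ?S\<^sup>2)"
  \<comment> \<open>Truncation is harmless for the coefficient of degree \<open>n\<close>, since
    \<open>q ^ i\<close> is divisible by \<open>fps_X ^ i\<close>.\<close>
  define T where "T = (\<Sum>i<Suc n. ?S * q ^ i)"
  have "fps_nth ?S 0 \<noteq> 0"
    by (subst schroder_fps_eq) simp
  then have S_nz: "?S \<noteq> 0"
    by auto
  have S: "?S * (1 - fps_X) = 1 - q"
    using schroder_fps_eq unfolding q_def by (simp add: algebra_simps)
  have "?S * (T * (1 - fps_X)) = T * (1 - q)"
    by (simp add: S [symmetric] algebra_simps)
  also have "\<dots> = ?S * ((1 - q) * (\<Sum>i<Suc n. q ^ i))"
    unfolding T_def by (simp only: sum_distrib_left [symmetric] mult_ac)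
  also have "\<dots> = ?S * (1 - q ^ Suc n)"
    by (simp only: one_diff_power_eq)
  \<comment> \<open>The factor \<open>?S\<close> cancels because integer power series form an
    integral domain.\<close>
  finally have T_eq: "T * (1 - fps_X) = 1 - q ^ Suc n"
    using S_nz by simp
  have q_pow: "q ^ i = fps_const ((- 1) ^ i) * (fps_X ^ i * ?S ^ (2 * i))" for i
  proof -
    have "q = fps_const (- 1) * (fps_X * ?S\<^sup>2)"
      by (simp add: q_def flip: fps_const_neg)
    then show ?thesis
      by (simp add: power_mult_distrib power_mult fps_const_power)
  qed
  \<comment> \<open>By \<open>T_eq\<close>, \<open>T * (1 - fps_X)\<close> agrees with 1 up to
    degree \<open>n\<close>, so consecutive coefficients of \<open>T\<close> are equal in that
    range.\<close>
  have T_nth: "fps_nth T k = 1" if "k \<le> n" for k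
    using that
  proof (induction k)
    case 0
    have "fps_nth (T * (1 - fps_X)) 0 = 1"
      unfolding T_eq q_pow by simp
    then show ?case
      by simp
  next
    case (Suc k)
    have "fps_nth (T * (1 - fps_X)) (Suc k) = 0"
      using Suc.prems unfolding T_eq q_pow fps_sub_nth fps_mult_left_const_nth
        fps_X_power_mult_nth by simp
    then have "fps_nth T (Suc k) = fps_nth T k"
      by (simp add: right_diff_distrib)
    with Suc show ?case
      by simp
  qed
  \<comment> \<open>The factor \<open>fps_X ^ i\<close> of \<open>q ^ i\<close> lowers the index to
    \<open>n - i\<close>, and the extra \<open>?S\<close> makes the exponent odd.\<close>
  have "fps_nth (?S * q ^ i) n = (- 1) ^ i * a (n - i) (2 * i + 1)" if "i \<le> n" for i
  proof -
    have "?S * q ^ i = fps_const ((- 1) ^ i) * (fps_X ^ i * ?S ^ (2 * i + 1))"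
      by (simp add: q_pow mult_ac)
    then show ?thesis
      using that unfolding a_def
      by (simp only: fps_mult_left_const_nth fps_X_power_mult_nth) simp
  qed
  then have "fps_nth T n = (\<Sum>i=0..n. (- 1) ^ i * a (n - i) (2 * i + 1))"
    unfolding T_def fps_sum_nth by (intro sum.cong) auto
  with T_nth[of n] show ?thesis
    by simp
qed

theorem theorem4p2:
  fixes n :: nat
  assumes "n \<ge> 1"
  shows "(\<exists>\<phi> :: step list \<Rightarrow> step list.
            \<forall>p \<in> {p \<in> free_schroder_paths n. Up \<in> set p}.
              \<phi> p \<in> {p \<in> free_schroder_paths n. Up \<in> set p} \<and>
              \<phi> (\<phi> p) = p \<and>
              (even (num_flaw_blocks (\<phi> p)) \<longleftrightarrow> odd (num_flaw_blocks p)))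
       \<and> (\<Sum>i=0..n. (- 1) ^ i * a (n - i) (2 * i + 1)) = 1"
proof (intro conjI exI ballI)
  fix p
  assume "p \<in> {p \<in> free_schroder_paths n. Up \<in> set p}"
  then have p: "p \<in> free_schroder_paths n" and not_flat: "\<not> set p \<subseteq> {Level}"
    using Up_in_free_schroder_path_iff by auto
  let ?q = "reflect_first_excursion p"
  have q: "?q \<in> free_schroder_paths n"
    using p by (simp add: free_schroder_paths_iff sum_vec_reflect_first_excursion)
  with reflect_first_excursion_not_flat[OF not_flat]
  show "?q \<in> {p \<in> free_schroder_paths n. Up \<in> set p}"
    using Up_in_free_schroder_path_iff by auto
  show "reflect_first_excursion ?q = p"
    by (rule reflect_first_excursion_involutive)
  show "even (num_flaw_blocks ?q) \<longleftrightarrow> odd (num_flaw_blocks p)"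
    using downs_from_axis_reflect_first_excursion[OF not_flat]
    by (simp only: num_flaw_blocks_eq_downs_from_axis[OF p]
        num_flaw_blocks_eq_downs_from_axis[OF q])
qed (rule alternating_schroder_sum)

end
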